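(* If $\Phi_1$ and $\Phi_2$ are $N$-functions, then the space $H^1_{\Phi_1,\Phi_2}(\mathbb{R})$, with its quotient topology, is not separated (i.e. not Hausdorff); in particular, $H^1_{\Phi_1,\Phi_2}(\mathbb{R})\neq0$.
   Context: An $N$-function is a function $\Phi:\mathbb{R}\to[0,\infty)$ that is even and convex, with $\Phi(x)=0\iff x=0$, $\lim_{x\to0}\Phi(x)/x=0$ and $\lim_{x\to\infty}\Phi(x)/x=\infty$. For a Riemannian manifold $X$ of dimension $n$ (here $X=\mathbb{R}$ with the standard metric, $n=1$) with volume element $d\mu_X$, and a measurable $k$-form $\omega$ with pointwise norm $|\omega(x)|$, put $\rho_\Phi(\omega)=\int_X\Phi(|\omega(x)|)\,d\mu_X$. Forms differing on a set of measure zero are identified. $L^\Phi(X,\Lambda^k)$ is the space of measurable $k$-forms $\omega$ with $\rho_\Phi(\alpha\omega)<\infty$ for some $\alpha>0$, endowed with the gauge norm $\|\omega\|_{(\Phi)}=\inf\{K>0:\rho_\Phi(\omega/K)\le1\}$; it is a Banach space. Weak differential: a locally integrable $(j+1)$-form $\theta$ is the (weak) differential $d\omega$ of a locally integrable $j$-form $\omega$ if $\int_U\omega\wedge du=(-1)^{j+1}\int_U\theta\wedge u$ for every orientable domain $U\subset\mathrm{Int}\,X$ and every smooth compactly supported $(n-j-1)$-form $u$ with support in $U$. $Z^k_{\Phi_2}(X)=\{\omega\in L^{\Phi_2}(X,\Lambda^k): d\omega=0\}$; $B^k_{\Phi_1,\Phi_2}(X)=\{\omega\in L^{\Phi_2}(X,\Lambda^k):\omega=d\beta\text{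 for some }\beta\in L^{\Phi_1}(X,\Lambda^{k-1})\}$; $H^k_{\Phi_1,\Phi_2}(X)=Z^k_{\Phi_2}(X)/B^k_{\Phi_1,\Phi_2}(X)$, endowed with the quotient seminorm and its topology. *)

theory Defs
  imports "HOL-Analysis.Analysis"
begin

definition N_function :: "(real \<Rightarrow> real) \<Rightarrow> bool" where
  "N_function \<Phi> \<longleftrightarrow>
     (\<forall>x. 0 \<le> \<Phi> x) \<and>
     (\<forall>x. \<Phi> (- x) = \<Phi> x) \<and>
     convex_on UNIV \<Phi> \<and>
     (\<forall>x. \<Phi> x = 0 \<longleftrightarrow> x = 0) \<and>
     ((\<lambda>x. \<Phi> x / x) \<longlongrightarrow> 0) (at 0) \<and>
     filterlim (\<lambda>x. \<Phi> x / x) at_top at_top"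

text \<open>
  Differential forms on the oriented Riemannian line are given by their coefficient function
  with respect to the global orthonormal frames \<open>1\<close> of \<open>\<Lambda>\<^sup>0\<close> and \<open>dx\<close> of \<open>\<Lambda>\<^sup>1\<close>; all other
  \<open>\<Lambda>\<^sup>k\<close> vanish.  Degrees are integers, because the test forms for the weak differential of
  a \<open>j\<close>-form have degree \<open>n - j - 1\<close> with \<open>n = 1\<close>, which may be negative.
  In these frames the pointwise norm is the absolute value of the coefficient, and the
  wedge product of forms of complementary degrees \<open>0\<close> and \<open>1\<close> (in either order) is the
  product of the coefficients.
\<close>

type_synonym form = "real \<Rightarrow> real"

definition forms :: "int \<Rightarrow> form set" where
  "forms k = {\<omega>. k \<notin> {0, 1} \<longrightarrow> (\<forall>x. \<omega> x = 0)}"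

definition modular :: "(real \<Rightarrow> real) \<Rightarrow> form \<Rightarrow> ennreal" where
  "modular \<Phi> \<omega> = (\<integral>\<^sup>+ x. ennreal (\<Phi> \<bar>\<omega> x\<bar>) \<partial>lebesgue)"

text \<open>
  Elements of \<open>orlicz_forms\<close> are representatives; forms that agree almost everywhere are
  identified only in the cohomology below, where this happens automatically because the
  null forms are exact (\<open>0\<close> is a primitive of each of them).
\<close>

definition orlicz_forms :: "(real \<Rightarrow> real) \<Rightarrow> int \<Rightarrow> form set" where
  "orlicz_forms \<Phi> k =
     {\<omega> \<in> forms k. \<omega> \<in> borel_measurable lebesgue \<and>
        (\<exists>\<alpha>>0. modular \<Phi> (\<lambda>x. \<alpha> * \<omega> x) < \<infinity>)}"

definition gauge_norm :: "(real \<Rightarrow> real) \<Rightarrow> form \<Rightarrow> real" where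
  "gauge_norm \<Phi> \<omega> = Inf {K. 0 < K \<and> modular \<Phi> (\<lambda>x. \<omega> x / K) \<le> 1}"

definition locally_integrable :: "form \<Rightarrow> bool" where
  "locally_integrable \<omega> \<longleftrightarrow> (\<forall>K. compact K \<longrightarrow> set_integrable lebesgue K \<omega>)"

text \<open>Smooth forms with compact support contained in \<open>U\<close>, extended by zero to the line.\<close>

definition test_forms :: "int \<Rightarrow> real set \<Rightarrow> form set" where
  "test_forms k U =
     {u \<in> forms k. (\<forall>m. (deriv ^^ m) u differentiable_on UNIV) \<and>
        compact (closure {x. u x \<noteq> 0}) \<and> closure {x. u x \<noteq> 0} \<subseteq> U}"

text \<open>Exterior derivative of a smooth form of degree \<open>k\<close>: \<open>d u = u' dx\<close> on functions.\<close>

definition ext_deriv :: "int \<Rightarrow> form \<Rightarrow> form" where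
  "ext_deriv k u = (if k = 0 then deriv u else (\<lambda>x. 0))"

text \<open>
  \<open>weak_diff j \<omega> \<theta>\<close>: the \<open>(j + 1)\<close>-form \<open>\<theta>\<close> is the weak differential of the \<open>j\<close>-form \<open>\<omega>\<close>.
  Both integrands are coefficients of \<open>1\<close>-forms, integrated for the standard orientation.
\<close>

definition weak_diff :: "int \<Rightarrow> form \<Rightarrow> form \<Rightarrow> bool" where
  "weak_diff j \<omega> \<theta> \<longleftrightarrow>
     \<omega> \<in> forms j \<and> \<theta> \<in> forms (j + 1) \<and>
     locally_integrable \<omega> \<and> locally_integrable \<theta> \<and>
     (\<forall>U u. open U \<and> connected U \<and> U \<noteq> {} \<and> u \<in> test_forms (1 - j - 1) U \<longrightarrow>
        (LINT x:U|lebesgue. \<omega> x * ext_deriv (1 - j - 1) u x) =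
        (- 1) powi (j + 1) * (LINT x:U|lebesgue. \<theta> x * u x))"

definition closed_forms :: "(real \<Rightarrow> real) \<Rightarrow> int \<Rightarrow> form set" where
  "closed_forms \<Phi>\<^sub>2 k = {\<omega> \<in> orlicz_forms \<Phi>\<^sub>2 k. weak_diff k \<omega> (\<lambda>x. 0)}"

definition exact_forms :: "(real \<Rightarrow> real) \<Rightarrow> (real \<Rightarrow> real) \<Rightarrow> int \<Rightarrow> form set" where
  "exact_forms \<Phi>\<^sub>1 \<Phi>\<^sub>2 k =
     {\<omega> \<in> orlicz_forms \<Phi>\<^sub>2 k. \<exists>\<beta> \<in> orlicz_forms \<Phi>\<^sub>1 (k - 1). weak_diff (k - 1) \<beta> \<omega>}"

definition cohomologous ::
  "(real \<Rightarrow> real) \<Rightarrow> (real \<Rightarrow> real) \<Rightarrow> int \<Rightarrow> (form \<times> form) set" where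
  "cohomologous \<Phi>\<^sub>1 \<Phi>\<^sub>2 k =
     {(\<omega>, \<eta>). \<omega> \<in> closed_forms \<Phi>\<^sub>2 k \<and> \<eta> \<in> closed_forms \<Phi>\<^sub>2 k \<and>
        (\<lambda>x. \<omega> x - \<eta> x) \<in> exact_forms \<Phi>\<^sub>1 \<Phi>\<^sub>2 k}"

definition orlicz_cohomology ::
  "(real \<Rightarrow> real) \<Rightarrow> (real \<Rightarrow> real) \<Rightarrow> int \<Rightarrow> form set set" where
  "orlicz_cohomology \<Phi>\<^sub>1 \<Phi>\<^sub>2 k = closed_forms \<Phi>\<^sub>2 k // cohomologous \<Phi>\<^sub>1 \<Phi>\<^sub>2 k"

definition coset_diff :: "form set \<Rightarrow> form set \<Rightarrow> form set" where
  "coset_diff c c' = {(\<lambda>x. \<omega> x - \<eta> x) | \<omega> \<eta>. \<omega> \<in> c \<and> \<eta> \<in> c'}"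

definition quotient_seminorm :: "(real \<Rightarrow> real) \<Rightarrow> form set \<Rightarrow> real" where
  "quotient_seminorm \<Phi>\<^sub>2 c = (INF \<omega>\<in>c. gauge_norm \<Phi>\<^sub>2 \<omega>)"

definition cohomology_ball ::
  "(real \<Rightarrow> real) \<Rightarrow> (real \<Rightarrow> real) \<Rightarrow> int \<Rightarrow> form set \<Rightarrow> real \<Rightarrow> form set set" where
  "cohomology_ball \<Phi>\<^sub>1 \<Phi>\<^sub>2 k c r =
     {c' \<in> orlicz_cohomology \<Phi>\<^sub>1 \<Phi>\<^sub>2 k. quotient_seminorm \<Phi>\<^sub>2 (coset_diff c' c) < r}"

definition cohomology_topology ::
  "(real \<Rightarrow> real) \<Rightarrow> (real \<Rightarrow> real) \<Rightarrow> int \<Rightarrow> form set topology" where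
  "cohomology_topology \<Phi>\<^sub>1 \<Phi>\<^sub>2 k =
     topology_generated_by
       {cohomology_ball \<Phi>\<^sub>1 \<Phi>\<^sub>2 k c r | c r. c \<in> orlicz_cohomology \<Phi>\<^sub>1 \<Phi>\<^sub>2 k \<and> 0 < r}"

end

theory Submission
  imports Defs
begin

text \<open>
  Every locally integrable \<open>1\<close>-form on the line is closed, so the question is which of them are
  exact.  The witness is \<open>\<omega> = 1\<^bsub>[0,1]\<^esub> dx\<close>.  Each of its primitives is constant on
  either side of \<open>[0,1]\<close>, and the two constants differ by \<open>1\<close>, so that no primitive is small at both
  ends of the line and \<open>\<omega>\<close> is not exact.  But \<open>\<omega>\<close> is a limit of exact forms: give the primitive
  a gentle descent back to \<open>0\<close> over a length \<open>L\<close>.  This tent function has compact support,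
  and its derivative differs from \<open>\<omega>\<close> by \<open>1 / L\<close> on an interval of length \<open>L\<close>,
  whose modular, after division by \<open>\<epsilon>\<close>, is \<open>L * \<Phi>\<^sub>2 (1 / (L * \<epsilon>))\<close>.  This tends to \<open>0\<close> for every
  \<open>\<epsilon> > 0\<close> because \<open>\<Phi>\<^sub>2 t / t \<rightarrow> 0\<close> at \<open>0\<close>
  (\<open>tent_diff_exact\<close>, \<open>tent_diff_approximates\<close>).

  Non-exactness (\<open>indicator_not_exact\<close>) is proved without determining the primitives.  A primitive
  \<open>\<beta>\<close> in the Orlicz space is tested against the dilates \<open>u x = \<psi> (x / R)\<close> of a fixed smooth bump
  \<open>\<psi>\<close>.  The pairing of \<open>\<omega>\<close> with \<open>u\<close> stays bounded below, whereas \<open>u'\<close> has size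
  \<open>1 / R\<close> on an interval of length \<open>2 R\<close>, so that the pairing of \<open>\<beta>\<close> with \<open>u'\<close> is a weighted
  mean of \<open>\<beta>\<close> over that interval.  Such means tend to \<open>0\<close>: convexity gives
  \<open>t \<le> \<epsilon> + C\<^sub>\<epsilon> * \<Phi>\<^sub>1 t\<close>, where the first term contributes \<open>O(\<epsilon>)\<close> and the
  second, whose integral is finite, contributes \<open>O(1 / R)\<close> (\<open>orlicz_pairing_bound\<close>).

  The triangle inequality for the gauge norm then shows that the classes of \<open>\<omega>\<close> and of \<open>0\<close>
  are distinct but at distance \<open>0\<close>: every ball that contains the class of \<open>0\<close> contains that of \<open>\<omega>\<close>
  (\<open>quotient_seminorm_limit_of_exact\<close>).  The same two classes show that the cohomology is not zero.
\<close>

section \<open>The modular and the gauge norm\<close>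

lemma N_function_nonneg: "N_function \<Phi> \<Longrightarrow> 0 \<le> \<Phi> x"
  by (simp add: N_function_def)

lemma N_function_zero: "N_function \<Phi> \<Longrightarrow> \<Phi> 0 = 0"
  by (simp add: N_function_def)

lemma N_function_scale_le:
  assumes "N_function \<Phi>" "0 \<le> t" "t \<le> 1"
  shows "\<Phi> (t * x) \<le> t * \<Phi> x"
proof -
  have "convex_on UNIV \<Phi>" using assms by (simp add: N_function_def)
  from convex_onD[OF this, of t 0 x] show ?thesis
    using assms N_function_zero[OF assms(1)] by simp
qed

lemma N_function_mono:
  assumes "N_function \<Phi>" "0 \<le> x" "x \<le> y"
  shows "\<Phi> x \<le> \<Phi> y"
proof (cases "y = 0")
  case False
  then have y: "y > 0" using assms by simp
  have "\<Phi> (x / y * y) \<le> x / y * \<Phi> y"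
    by (rule N_function_scale_le) (use assms y in auto)
  also have "\<dots> \<le> 1 * \<Phi> y"
    by (rule mult_right_mono) (use assms y in \<open>auto simp: N_function_nonneg\<close>)
  finally show ?thesis using y by simp
qed (use assms in auto)

lemma N_function_borel:
  assumes "N_function \<Phi>" shows "\<Phi> \<in> borel_measurable borel"
proof -
  have "convex_on UNIV \<Phi>" using assms by (simp add: N_function_def)
  then have "continuous_on UNIV \<Phi>" by (intro convex_on_continuous) auto
  then show ?thesis by (rule borel_measurable_continuous_onI)
qed

text \<open>
  Beyond \<open>\<epsilon>\<close> a convex function vanishing at \<open>0\<close> lies above the line through the
  origin and \<open>(\<epsilon>, \<Phi> \<epsilon>)\<close>.  This is what makes Orlicz functions small in mean at infinity.
\<close>
lemma N_function_linear_bound: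
  assumes "N_function \<Phi>" "0 < \<epsilon>" "0 \<le> t"
  shows "t \<le> \<epsilon> + \<epsilon> / \<Phi> \<epsilon> * \<Phi> t"
proof -
  have pos: "\<Phi> \<epsilon> > 0"
    using assms N_function_nonneg[OF assms(1), of \<epsilon>] by (auto simp: N_function_def less_le)
  show ?thesis
  proof (cases "t \<le> \<epsilon>")
    case True
    moreover have "0 \<le> \<epsilon> / \<Phi> \<epsilon> * \<Phi> t"
      using assms pos N_function_nonneg[OF assms(1), of t] by simp
    ultimately show ?thesis by linarith
  next
    case False
    have "\<Phi> (\<epsilon> / t * t) \<le> \<epsilon> / t * \<Phi> t"
      by (rule N_function_scale_le) (use assms False in auto)
    then have "t \<le> \<epsilon> / \<Phi> \<epsilon> * \<Phi> t" using assms False pos by (simp add: field_simps)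
    then show ?thesis using assms by linarith
  qed
qed

lemma modular_convex_combination:
  assumes "N_function \<Phi>" "f \<in> borel_measurable lebesgue" "g \<in> borel_measurable lebesgue"
    and "0 \<le> s" "0 \<le> t" "s + t = 1"
  shows "modular \<Phi> (\<lambda>x. s * f x + t * g x)
           \<le> ennreal s * modular \<Phi> f + ennreal t * modular \<Phi> g"
proof -
  have [measurable]: "\<Phi> \<in> borel_measurable borel" "f \<in> borel_measurable lebesgue"
      "g \<in> borel_measurable lebesgue"
    using assms N_function_borel by auto
  have pw: "\<Phi> \<bar>s * f x + t * g x\<bar> \<le> s * \<Phi> \<bar>f x\<bar> + t * \<Phi> \<bar>g x\<bar>" for x
  proof -
    have "\<Phi> \<bar>s * f x + t * g x\<bar> \<le> \<Phi> (s * \<bar>f x\<bar> + t * \<bar>g x\<bar>)"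
      by (rule N_function_mono[OF assms(1)])
         (use assms abs_triangle_ineq[of "s * f x" "t * g x"] in \<open>auto simp: abs_mult\<close>)
    also have "\<dots> \<le> s * \<Phi> \<bar>f x\<bar> + t * \<Phi> \<bar>g x\<bar>"
    proof -
      have "convex_on UNIV \<Phi>" using assms by (simp add: N_function_def)
      from convex_onD[OF this, of t "\<bar>f x\<bar>" "\<bar>g x\<bar>"] show ?thesis
        using assms by (simp add: eq_diff_eq[symmetric])
    qed
    finally show ?thesis .
  qed
  have "modular \<Phi> (\<lambda>x. s * f x + t * g x)
      \<le> (\<integral>\<^sup>+x. ennreal s * ennreal (\<Phi> \<bar>f x\<bar>) + ennreal t * ennreal (\<Phi> \<bar>g x\<bar>) \<partial>lebesgue)"
    unfolding modular_def
  proof (rule nn_integral_mono)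
    fix x
    show "ennreal (\<Phi> \<bar>s * f x + t * g x\<bar>)
        \<le> ennreal s * ennreal (\<Phi> \<bar>f x\<bar>) + ennreal t * ennreal (\<Phi> \<bar>g x\<bar>)"
      using pw[of x] assms
      by (simp add: N_function_nonneg flip: ennreal_mult ennreal_plus)
  qed
  also have "\<dots> = ennreal s * modular \<Phi> f + ennreal t * modular \<Phi> g"
    unfolding modular_def by (simp add: nn_integral_add nn_integral_cmult)
  finally show ?thesis .
qed

lemma modular_mono:
  assumes "N_function \<Phi>" "\<And>x. \<bar>f x\<bar> \<le> \<bar>g x\<bar>"
  shows "modular \<Phi> f \<le> modular \<Phi> g"
  unfolding modular_def
  by (intro nn_integral_mono ennreal_leI N_function_mono[OF assms(1)] assms abs_ge_zero)

lemma modular_zero: "N_function \<Phi> \<Longrightarrow> modular \<Phi> (\<lambda>x. 0) = 0"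
  by (simp add: modular_def N_function_zero)

lemma modular_scale_le:
  assumes "N_function \<Phi>" "f \<in> borel_measurable lebesgue" "0 \<le> t" "t \<le> 1"
  shows "modular \<Phi> (\<lambda>x. t * f x) \<le> ennreal t * modular \<Phi> f"
  using modular_convex_combination[OF assms(1,2), of "\<lambda>x. 0" t "1 - t"] assms
  by (simp add: modular_zero)

lemma orlicz_forms_measurable:
  "f \<in> orlicz_forms \<Phi> k \<Longrightarrow> f \<in> borel_measurable lebesgue"
  by (simp add: orlicz_forms_def)

lemma orlicz_forms_diff:
  assumes "N_function \<Phi>" "f \<in> orlicz_forms \<Phi> k" "g \<in> orlicz_forms \<Phi> k"
  shows "(\<lambda>x. f x - g x) \<in> orlicz_forms \<Phi> k"
proof -
  have [measurable]: "f \<in> borel_measurable lebesgue" "g \<in> borel_measurable lebesgue"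
    using assms by (auto simp: orlicz_forms_def)
  obtain a b where ab: "a > 0" "b > 0" "modular \<Phi> (\<lambda>x. a * f x) < \<infinity>" "modular \<Phi> (\<lambda>x. b * g x) < \<infinity>"
    using assms by (auto simp: orlicz_forms_def)
  \<comment> \<open>With half of the smaller scale, \<open>c (f - g)\<close> is dominated by the midpoint of \<open>a \<bar>f\<bar>\<close> and \<open>b \<bar>g\<bar>\<close>.\<close>
  define c where "c = min a b / 2"
  have "modular \<Phi> (\<lambda>x. c * (f x - g x))
      \<le> modular \<Phi> (\<lambda>x. (1/2) * (a * \<bar>f x\<bar>) + (1/2) * (b * \<bar>g x\<bar>))"
  proof (rule modular_mono[OF assms(1)])
    fix x
    have "\<bar>c * (f x - g x)\<bar> \<le> c * (\<bar>f x\<bar> + \<bar>g x\<bar>)"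
      using ab by (auto simp: c_def abs_mult intro!: mult_left_mono)
    also have "\<dots> \<le> (1/2) * (a * \<bar>f x\<bar>) + (1/2) * (b * \<bar>g x\<bar>)"
      unfolding c_def
      using mult_right_mono[of "min a b" a "\<bar>f x\<bar>"] mult_right_mono[of "min a b" b "\<bar>g x\<bar>"]
      by (simp add: algebra_simps)
    finally show "\<bar>c * (f x - g x)\<bar> \<le> \<bar>(1/2) * (a * \<bar>f x\<bar>) + (1/2) * (b * \<bar>g x\<bar>)\<bar>" by linarith
  qed
  also have "\<dots> \<le> ennreal (1/2) * modular \<Phi> (\<lambda>x. a * \<bar>f x\<bar>) + ennreal (1/2) * modular \<Phi> (\<lambda>x. b * \<bar>g x\<bar>)"
    by (rule modular_convex_combination) (use assms in auto)
  also have "modular \<Phi> (\<lambda>x. a * \<bar>f x\<bar>) = modular \<Phi> (\<lambda>x. a * f x)"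
    by (simp add: modular_def abs_mult)
  also have "modular \<Phi> (\<lambda>x. b * \<bar>g x\<bar>) = modular \<Phi> (\<lambda>x. b * g x)"
    by (simp add: modular_def abs_mult)
  also have "ennreal (1/2) * modular \<Phi> (\<lambda>x. a * f x) + ennreal (1/2) * modular \<Phi> (\<lambda>x. b * g x) < \<infinity>"
    using ab by (simp only: infinity_ennreal_def ennreal_add_less_top ennreal_mult_less_top
      ennreal_less_top simp_thms)
  finally have "modular \<Phi> (\<lambda>x. c * (f x - g x)) < \<infinity>" .
  moreover have "c > 0" using ab by (simp add: c_def)
  ultimately show ?thesis using assms by (auto simp: orlicz_forms_def forms_def)
qed

text \<open>
  The infimum that defines the gauge norm is over a nonempty set: if the modular of \<open>\<alpha> f\<close> is \<open>M\<close>,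
  convexity brings it below \<open>1\<close> after a further division by \<open>M + 1\<close>.
\<close>
lemma gauge_norm_set_nonempty:
  assumes "N_function \<Phi>" "f \<in> orlicz_forms \<Phi> k"
  shows "\<exists>K>0. modular \<Phi> (\<lambda>x. f x / K) \<le> 1"
proof -
  have [measurable]: "f \<in> borel_measurable lebesgue" using assms by (simp add: orlicz_forms_def)
  obtain a where a: "a > 0" "modular \<Phi> (\<lambda>x. a * f x) < \<infinity>" using assms by (auto simp: orlicz_forms_def)
  then obtain M where M: "0 \<le> M" "modular \<Phi> (\<lambda>x. a * f x) = ennreal M"
    by (metis ennreal_cases infinity_ennreal_def less_irrefl)
  define t where "t = 1 / (M + 1)"
  have "modular \<Phi> (\<lambda>x. t * (a * f x)) \<le> ennreal t * modular \<Phi> (\<lambda>x. a * f x)"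
    by (rule modular_scale_le) (use assms M in \<open>auto simp: t_def\<close>)
  also have "\<dots> = ennreal (t * M)" using M by (simp add: t_def flip: ennreal_mult)
  also have "\<dots> \<le> 1" using M by (simp add: t_def)
  finally have "modular \<Phi> (\<lambda>x. f x / (1 / (t * a))) \<le> 1" by (simp add: mult_ac)
  moreover have "1 / (t * a) > 0" using M a by (simp add: t_def)
  ultimately show ?thesis by blast
qed

lemma gauge_norm_nonneg:
  assumes "N_function \<Phi>" "f \<in> orlicz_forms \<Phi> k"
  shows "0 \<le> gauge_norm \<Phi> f"
  unfolding gauge_norm_def using gauge_norm_set_nonempty[OF assms]
  by (intro cInf_greatest) auto

lemma gauge_norm_le:
  assumes "0 < K" "modular \<Phi> (\<lambda>x. f x / K) \<le> 1"
  shows "gauge_norm \<Phi> f \<le> K"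
  unfolding gauge_norm_def
  by (rule cInf_lower) (use assms in \<open>auto intro!: bdd_belowI[of _ 0]\<close>)

lemma modular_le_one_of_gauge_norm_less:
  assumes "N_function \<Phi>" "f \<in> orlicz_forms \<Phi> k" "gauge_norm \<Phi> f < K"
  shows "0 < K" "modular \<Phi> (\<lambda>x. f x / K) \<le> 1"
proof -
  show K: "0 < K" using gauge_norm_nonneg[OF assms(1,2)] assms(3) by linarith
  obtain K' where K': "0 < K'" "modular \<Phi> (\<lambda>x. f x / K') \<le> 1" "K' < K"
    using cInf_lessD[of "{K. 0 < K \<and> modular \<Phi> (\<lambda>x. f x / K) \<le> 1}" K]
      gauge_norm_set_nonempty[OF assms(1,2)] assms(3)
    by (auto simp: gauge_norm_def)
  have "modular \<Phi> (\<lambda>x. f x / K) \<le> modular \<Phi> (\<lambda>x. f x / K')"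
    by (rule modular_mono[OF assms(1)]) (use K' in \<open>auto intro!: divide_left_mono\<close>)
  then show "modular \<Phi> (\<lambda>x. f x / K) \<le> 1" using K' by (rule_tac order_trans)
qed

text \<open>
  For \<open>A\<close> and \<open>B\<close> slightly above the two norms, \<open>(f + g) / (A + B)\<close> is the convex combination
  of \<open>f / A\<close> and \<open>g / B\<close> with weights \<open>A / (A + B)\<close> and \<open>B / (A + B)\<close>.
\<close>
lemma gauge_norm_triangle:
  assumes "N_function \<Phi>" "f \<in> orlicz_forms \<Phi> k" "g \<in> orlicz_forms \<Phi> k"
  shows "gauge_norm \<Phi> (\<lambda>x. f x + g x) \<le> gauge_norm \<Phi> f + gauge_norm \<Phi> g"
proof (rule field_le_epsilon)
  fix e :: real assume e: "0 < e"
  define A B where "A = gauge_norm \<Phi> f + e / 2" and "B = gauge_norm \<Phi> g + e / 2"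
  have A: "0 < A" "modular \<Phi> (\<lambda>x. f x / A) \<le> 1"
    using modular_le_one_of_gauge_norm_less[OF assms(1,2), of A] e by (auto simp: A_def)
  have B: "0 < B" "modular \<Phi> (\<lambda>x. g x / B) \<le> 1"
    using modular_le_one_of_gauge_norm_less[OF assms(1,3), of B] e by (auto simp: B_def)
  have [measurable]: "f \<in> borel_measurable lebesgue" "g \<in> borel_measurable lebesgue"
    using assms by (auto simp: orlicz_forms_def)
  have AB: "A / (A + B) + B / (A + B) = 1" using A B by (simp flip: add_divide_distrib)
  have "modular \<Phi> (\<lambda>x. (f x + g x) / (A + B))
      = modular \<Phi> (\<lambda>x. A / (A + B) * (f x / A) + B / (A + B) * (g x / B))"
    using A B by (simp add: add_divide_distrib)
  also have "\<dots> \<le> ennreal (A / (A + B)) * modular \<Phi> (\<lambda>x. f x / A)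
      + ennreal (B / (A + B)) * modular \<Phi> (\<lambda>x. g x / B)"
    by (rule modular_convex_combination) (use assms A B AB in auto)
  also have "\<dots> \<le> ennreal (A / (A + B)) * 1 + ennreal (B / (A + B)) * 1"
    using A B by (intro add_mono mult_left_mono) auto
  also have "\<dots> = ennreal (A / (A + B) + B / (A + B))" using A B by (subst ennreal_plus) auto
  also note AB
  finally have "gauge_norm \<Phi> (\<lambda>x. f x + g x) \<le> A + B" using A B by (intro gauge_norm_le) auto
  then show "gauge_norm \<Phi> (\<lambda>x. f x + g x) \<le> gauge_norm \<Phi> f + gauge_norm \<Phi> g + e"
    by (simp add: A_def B_def)
qed

lemma orlicz_forms_bounded_support:
  assumes "N_function \<Phi>" "f \<in> borel_measurable lebesgue" "f \<in> forms k"
    and "\<And>x. \<bar>f x\<bar> \<le> C" and "\<And>x. x \<notin> {a..b} \<Longrightarrow> f x = 0"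
  shows "f \<in> orlicz_forms \<Phi> k"
proof -
  have "modular \<Phi> (\<lambda>x. 1 * f x) \<le> (\<integral>\<^sup>+x. ennreal (\<Phi> C) * indicator {a..b} x \<partial>lebesgue)"
    unfolding modular_def
  proof (rule nn_integral_mono)
    fix x show "ennreal (\<Phi> \<bar>1 * f x\<bar>) \<le> ennreal (\<Phi> C) * indicator {a..b} x"
      using assms(5)[of x] N_function_mono[OF assms(1), of "\<bar>f x\<bar>" C] assms(4)[of x]
      by (cases "x \<in> {a..b}") (auto simp: N_function_zero[OF assms(1)] intro!: ennreal_leI)
  qed
  also have "\<dots> = ennreal (\<Phi> C) * emeasure lebesgue {a..b}"
    by (rule nn_integral_cmult_indicator) auto
  also have "\<dots> < \<infinity>"
    by (simp add: ennreal_mult_less_top emeasure_lborel_Icc_eq)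
  finally show ?thesis using assms unfolding orlicz_forms_def 
    by (auto intro!: exI[of _ "1::real"])
qed

section \<open>Weak differentials of functions on the line\<close>

lemma forms_0_1 [simp]: "f \<in> forms 0" "f \<in> forms 1"
  by (auto simp: forms_def)

lemma locally_integrable_bounded:
  assumes "f \<in> borel_measurable lebesgue" "\<And>x. \<bar>f x\<bar> \<le> C"
  shows "locally_integrable f"
  unfolding locally_integrable_def set_integrable_def
proof (intro allI impI)
  fix K :: "real set" assume K: "compact K"
  show "integrable lebesgue (\<lambda>x. indicat_real K x *\<^sub>R f x)"
  proof (rule integrableI_bounded_set_indicator[where B = C])
    show "K \<in> sets lebesgue" using K by (simp add: borel_compact)
    show "emeasure lebesgue K < \<infinity>" using K emeasure_compact_finite[OF K] by (simp add: borel_compact)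
  qed (use assms in auto)
qed

lemma lebesgue_measurable_continuous:
  fixes f :: "real \<Rightarrow> real"
  assumes "continuous_on UNIV f" shows "f \<in> borel_measurable lebesgue"
  using borel_measurable_continuous_onI[OF assms] by (intro measurable_completion) simp

lemma locally_integrable_continuous:
  assumes "continuous_on UNIV f" shows "locally_integrable f"
  unfolding locally_integrable_def set_integrable_def
proof (intro allI impI)
  fix K :: "real set" assume K: "compact K"
  have "integrable lborel (\<lambda>x. indicat_real K x *\<^sub>R f x)"
    by (rule borel_integrable_compact[OF K continuous_on_subset[OF assms]]) simp
  then show "integrable lebesgue (\<lambda>x. indicat_real K x *\<^sub>R f x)"
    by (subst integrable_completion) auto
qed

lemma locally_integrable_diff:
  "locally_integrable f \<Longrightarrow> locally_integrable g \<Longrightarrow> locally_integrable (\<lambda>x. f x - g x)"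
  unfolding locally_integrable_def by (auto intro: set_integral_diff)

lemma integrable_locally_integrable_mult:
  assumes "locally_integrable f" "continuous_on UNIV g" "\<And>x. x \<notin> {a..b} \<Longrightarrow> g x = 0"
  shows "integrable lebesgue (\<lambda>x. f x * g x)"
proof -
  have f: "integrable lebesgue (\<lambda>x. indicat_real {a..b} x * f x)"
    using assms(1) by (auto simp: locally_integrable_def set_integrable_def)
  have [measurable]: "g \<in> borel_measurable lebesgue"
    by (rule lebesgue_measurable_continuous[OF assms(2)])
  have "bounded (g ` {a..b})"
    by (intro compact_imp_bounded compact_continuous_image continuous_on_subset[OF assms(2)]) auto
  then obtain C where C: "\<And>x. x \<in> {a..b} \<Longrightarrow> \<bar>g x\<bar> \<le> C"
    unfolding bounded_iff by force
  have eq: "(\<lambda>x. f x * g x) = (\<lambda>x. (indicat_real {a..b} x * f x) * g x)"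
    using assms(3) by (auto simp: indicator_def fun_eq_iff)
  show ?thesis unfolding eq
  proof (rule Bochner_Integration.integrable_bound)
    show "integrable lebesgue (\<lambda>x. C * (indicat_real {a..b} x * f x))"
      by (intro integrable_mult_right f)
    show "(\<lambda>x. indicat_real {a..b} x * f x * g x) \<in> borel_measurable lebesgue"
      using borel_measurable_integrable[OF f] by measurable
    have "norm (indicat_real {a..b} x * f x * g x) \<le> norm (C * (indicat_real {a..b} x * f x))" for x
    proof (cases "x \<in> {a..b}")
      case True
      have "\<bar>f x\<bar> * \<bar>g x\<bar> \<le> \<bar>f x\<bar> * \<bar>C\<bar>"
        using C[OF True] by (intro mult_left_mono) auto
      then show ?thesis using True by (simp add: abs_mult mult.commute)
    qed simp
    then show "AE x in lebesgue. norm (indicat_real {a..b} x * f x * g x)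
        \<le> norm (C * (indicat_real {a..b} x * f x))" by simp
  qed
qed

lemma test_form_has_derivative:
  assumes "u \<in> test_forms k U" shows "(u has_real_derivative deriv u x) (at x)"
proof -
  have "(deriv ^^ 0) u differentiable_on UNIV" using assms unfolding test_forms_def by blast
  then show ?thesis by (simp add: differentiable_on_def DERIV_deriv_iff_real_differentiable)
qed

lemma test_form_continuous:
  assumes "u \<in> test_forms k U"
  shows "continuous_on UNIV u" "continuous_on UNIV (deriv u)"
proof -
  have "(deriv ^^ 0) u differentiable_on UNIV" "(deriv ^^ 1) u differentiable_on UNIV"
    using assms unfolding test_forms_def by blast+
  then show "continuous_on UNIV u" "continuous_on UNIV (deriv u)"
    by (auto intro: differentiable_imp_continuous_on)
qed

lemma deriv_outside_support:
  fixes u :: "real \<Rightarrow> real"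
  assumes "x \<notin> closure {x. u x \<noteq> 0}"
  shows "u x = 0" "deriv u x = 0"
proof -
  have off: "u y = 0" if "y \<notin> closure {x. u x \<noteq> 0}" for y
    using that closure_subset[of "{x. u x \<noteq> 0}"] by blast
  show "u x = 0" by (rule off[OF assms])
  have "((\<lambda>_. 0) has_real_derivative 0) (at x)" by simp
  then have "(u has_real_derivative 0) (at x)"
  proof (rule has_field_derivative_transform_within_open)
    show "open (- closure {x. u x \<noteq> 0})" by (rule open_Compl[OF closed_closure])
    show "x \<in> - closure {x. u x \<noteq> 0}" using assms by blast
    show "0 = u y" if "y \<in> - closure {x. u x \<noteq> 0}" for y
      using off that by (metis ComplD)
  qed
  then show "deriv u x = 0" by (rule DERIV_imp_deriv)
qed

lemma test_form_support:
  assumes "u \<in> test_forms k U"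
  shows "\<exists>a b. a \<le> b \<and> (\<forall>x. x \<notin> {a..b} \<longrightarrow> u x = 0 \<and> deriv u x = 0)"
proof -
  have "bounded (closure {x. u x \<noteq> 0})"
    using assms by (auto simp: test_forms_def intro: compact_imp_bounded)
  then obtain C where C: "\<And>x. x \<in> closure {x. u x \<noteq> 0} \<Longrightarrow> \<bar>x\<bar> \<le> C" by (auto simp: bounded_iff)
  have "u x = 0 \<and> deriv u x = 0" if "x \<notin> {- \<bar>C\<bar>..\<bar>C\<bar>}" for x
  proof -
    have "x \<notin> closure {x. u x \<noteq> 0}" using C[of x] that by auto
    from deriv_outside_support[OF this] show ?thesis by (rule conjI)
  qed
  then show ?thesis by (intro exI[of _ "- \<bar>C\<bar>"] exI[of _ "\<bar>C\<bar>"]) simp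
qed

lemma test_form_mult_integrable:
  assumes "locally_integrable f" "u \<in> test_forms k U"
  shows "integrable lebesgue (\<lambda>x. f x * u x)" "integrable lebesgue (\<lambda>x. f x * deriv u x)"
proof -
  obtain a b where ab: "a \<le> b" "\<And>x. x \<notin> {a..b} \<Longrightarrow> u x = 0" "\<And>x. x \<notin> {a..b} \<Longrightarrow> deriv u x = 0"
    using test_form_support[OF assms(2)] by blast
  show "integrable lebesgue (\<lambda>x. f x * u x)"
    using assms(1) test_form_continuous(1)[OF assms(2)] ab(2)
    by (rule integrable_locally_integrable_mult)
  show "integrable lebesgue (\<lambda>x. f x * deriv u x)"
    using assms(1) test_form_continuous(2)[OF assms(2)] ab(3)
    by (rule integrable_locally_integrable_mult)
qed

text \<open>
  A test form with support in \<open>U\<close> is also one on the whole line, and both integrands vanish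
  outside \<open>U\<close>; hence the single domain \<open>U = UNIV\<close> suffices.
\<close>
lemma weak_diff_0_iff:
  "weak_diff 0 \<beta> \<theta> \<longleftrightarrow> locally_integrable \<beta> \<and> locally_integrable \<theta> \<and>
     (\<forall>u \<in> test_forms 0 UNIV.
        (LINT x|lebesgue. \<beta> x * deriv u x) = - (LINT x|lebesgue. \<theta> x * u x))"
proof -
  have restrict: "(LINT x:U|lebesgue. f x * u x) = (LINT x|lebesgue. f x * u x)"
      "(LINT x:U|lebesgue. f x * deriv u x) = (LINT x|lebesgue. f x * deriv u x)"
    if "u \<in> test_forms 0 U" for f u U
  proof -
    have off: "u x = 0" "deriv u x = 0" if "x \<notin> U" for x
    proof -
      have "x \<notin> closure {x. u x \<noteq> 0}"
        using \<open>u \<in> test_forms 0 U\<close> that unfolding test_forms_def by blast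
      then show "u x = 0" "deriv u x = 0" by (rule deriv_outside_support)+
    qed
    then show "(LINT x:U|lebesgue. f x * u x) = (LINT x|lebesgue. f x * u x)"
        "(LINT x:U|lebesgue. f x * deriv u x) = (LINT x|lebesgue. f x * deriv u x)"
      unfolding set_lebesgue_integral_def
      by (auto intro!: Bochner_Integration.integral_cong simp: indicator_def)
  qed
  have sub: "u \<in> test_forms 0 UNIV" if "u \<in> test_forms 0 U" for u U
    using that by (auto simp: test_forms_def)
  have "(\<forall>U u. open U \<and> connected U \<and> U \<noteq> {} \<and> u \<in> test_forms 0 U \<longrightarrow>
          (LINT x:U|lebesgue. \<beta> x * deriv u x) = - (LINT x:U|lebesgue. \<theta> x * u x)) \<longleftrightarrow>
        (\<forall>u \<in> test_forms 0 UNIV.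
          (LINT x|lebesgue. \<beta> x * deriv u x) = - (LINT x|lebesgue. \<theta> x * u x))" (is "?L = ?R")
  proof
    assume L: ?L
    show ?R
    proof
      fix u :: form assume u: "u \<in> test_forms 0 UNIV"
      from L[rule_format, of UNIV u] u
      show "(LINT x|lebesgue. \<beta> x * deriv u x) = - (LINT x|lebesgue. \<theta> x * u x)"
        by (simp add: restrict[OF u])
    qed
  next
    assume R: ?R
    show ?L
    proof (intro allI impI, elim conjE)
      fix U u assume u: "u \<in> test_forms 0 U"
      from R[rule_format, OF sub[OF u]]
      show "(LINT x:U|lebesgue. \<beta> x * deriv u x) = - (LINT x:U|lebesgue. \<theta> x * u x)"
        by (simp add: restrict[OF u])
    qed
  qed
  then show ?thesis by (simp add: weak_diff_def forms_def ext_deriv_def)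
qed

lemma weak_diff_0_diff:
  assumes "weak_diff 0 f \<theta>" "weak_diff 0 g \<eta>"
  shows "weak_diff 0 (\<lambda>x. f x - g x) (\<lambda>x. \<theta> x - \<eta> x)"
  using assms unfolding weak_diff_0_iff
  by (auto simp: locally_integrable_diff left_diff_distrib test_form_mult_integrable)

text \<open>
  Integration by parts: \<open>\<beta> u\<close> is continuous with compact support and has derivative
  \<open>\<beta> u' + \<theta> u\<close> off a finite set, so the integral of this derivative is \<open>0\<close>.
\<close>
lemma weak_diff_of_piecewise_derivative:
  assumes "finite S" "continuous_on UNIV \<beta>"
    and "\<And>x. x \<notin> S \<Longrightarrow> (\<beta> has_real_derivative \<theta> x) (at x)" "locally_integrable \<theta>"
  shows "weak_diff 0 \<beta> \<theta>"
  unfolding weak_diff_0_iff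
proof (intro conjI ballI)
  show \<beta>: "locally_integrable \<beta>" by (rule locally_integrable_continuous[OF assms(2)])
  fix u :: form assume u: "u \<in> test_forms 0 UNIV"
  obtain a b where ab: "a \<le> b" "\<And>x. x \<notin> {a..b} \<Longrightarrow> u x = 0" "\<And>x. x \<notin> {a..b} \<Longrightarrow> deriv u x = 0"
    using test_form_support[OF u] by blast
  define h where "h = (\<lambda>x. \<beta> x * deriv u x + \<theta> x * u x)"
  note int = test_form_mult_integrable[OF \<beta> u] test_form_mult_integrable[OF assms(4) u]
  have h: "integrable lebesgue h" unfolding h_def using int by auto
  \<comment> \<open>The interval is enlarged by \<open>1\<close> on each side because \<open>u\<close> may be nonzero at \<open>a\<close> and \<open>b\<close>.\<close>
  have "(h has_integral \<beta> (b + 1) * u (b + 1) - \<beta> (a - 1) * u (a - 1)) {a - 1..b + 1}"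
  proof (rule fundamental_theorem_of_calculus_interior_strong[OF assms(1)])
    show "continuous_on {a - 1..b + 1} (\<lambda>x. \<beta> x * u x)"
      using continuous_on_subset[OF assms(2)] continuous_on_subset[OF test_form_continuous(1)[OF u]]
      by (intro continuous_intros) auto
    fix x assume "x \<in> {a - 1<..<b + 1} - S"
    then show "((\<lambda>x. \<beta> x * u x) has_vector_derivative h x) (at x)"
      using DERIV_mult[OF assms(3) test_form_has_derivative[OF u], of x]
      by (simp add: has_real_derivative_iff_has_vector_derivative[symmetric] h_def algebra_simps)
  qed (use ab in auto)
  then have "integral {a - 1..b + 1} h = 0" using ab by (simp add: integral_unique)
  moreover have "set_integrable lebesgue {a - 1..b + 1} h"
    using h unfolding set_integrable_def by (intro integrable_mult_indicator) auto
  ultimately have "(LINT x:{a - 1..b + 1}|lebesgue. h x) = 0"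
    by (simp add: set_lebesgue_integral_eq_integral)
  moreover have "h x = 0" if "x \<notin> {a - 1..b + 1}" for x
  proof -
    have "x \<notin> {a..b}" using that by auto
    from ab(2,3)[OF this] show ?thesis by (simp add: h_def)
  qed
  then have "indicator {a - 1..b + 1} x *\<^sub>R h x = h x" for x
    by (cases "x \<in> {a - 1..b + 1}") auto
  then have "(LINT x:{a - 1..b + 1}|lebesgue. h x) = (LINT x|lebesgue. h x)"
    unfolding set_lebesgue_integral_def by presburger
  ultimately show "(LINT x|lebesgue. \<beta> x * deriv u x) = - (LINT x|lebesgue. \<theta> x * u x)"
    using int by (simp add: h_def)
qed (rule assms(4))

section \<open>Smooth bump functions\<close>

lemma exp_inverse_power_bound:
  fixes s :: real assumes "0 < s"
  shows "exp (- 1 / s) / s ^ n \<le> fact n"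
proof -
  have "(1 / s) ^ n / fact n \<le> exp (1 / s)"
    using sum_le_suminf[OF summable_exp[of "1 / s"], of "{n}"] assms
    by (simp add: exp_def divide_inverse mult.commute)
  then show ?thesis using assms by (simp add: field_simps exp_minus power_divide)
qed

text \<open>
  The standard bump is \<open>bump 1 0\<close>.  The factors \<open>P\<close> and \<open>1 / (1 - y\<^sup>2) ^ k\<close>
  make the family closed under differentiation, so that smoothness of every
  member follows by iterating first derivatives; \<open>bump_diff\<close> is the numerator that the
  product rule produces.
\<close>
definition bump :: "real poly \<Rightarrow> nat \<Rightarrow> real \<Rightarrow> real" where
  "bump P k y = (if \<bar>y\<bar> < 1 then poly P y / (1 - y\<^sup>2) ^ k * exp (- 1 / (1 - y\<^sup>2)) else 0)"

definition bump_diff :: "real poly \<Rightarrow> nat \<Rightarrow> real poly" where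
  "bump_diff P k = pderiv P * [:1, 0, -1:]\<^sup>2 + smult (2 * real k) ([:0, 1:] * P * [:1, 0, -1:])
     - smult 2 ([:0, 1:] * P)"

lemma poly_bounded_unit:
  fixes P :: "real poly"
  obtains M where "0 \<le> M" "\<And>y. \<bar>y\<bar> \<le> 1 \<Longrightarrow> \<bar>poly P y\<bar> \<le> M"
proof -
  have "compact (poly P ` {-1..1})"
    by (intro compact_continuous_image continuous_intros) auto
  then obtain M where "\<And>y. y \<in> {-1..1} \<Longrightarrow> \<bar>poly P y\<bar> \<le> M"
    using compact_imp_bounded by (force simp: bounded_iff)
  then show ?thesis by (intro that[of "\<bar>M\<bar>"]) (force simp: abs_le_iff)+
qed

text \<open>
  With \<open>s = 1 - y\<^sup>2\<close>, the factor \<open>exp (- 1 / s)\<close> absorbs every power of \<open>1 / s\<close>, so a member of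
  the family vanishes to every order at the end points.
\<close>
lemma bump_decay:
  obtains C where "0 \<le> C" "\<And>y. \<bar>y\<bar> < 1 \<Longrightarrow> \<bar>bump P k y\<bar> \<le> C * (1 - y\<^sup>2) ^ m"
proof -
  obtain M where M: "0 \<le> M" "\<And>y. \<bar>y\<bar> \<le> 1 \<Longrightarrow> \<bar>poly P y\<bar> \<le> M" 
    using poly_bounded_unit by blast
  show ?thesis
  proof (rule that[of "M * fact (k + m)"])
    fix y :: real assume y: "\<bar>y\<bar> < 1"
    define s where "s = 1 - y\<^sup>2"
    have s: "s > 0" using y by (simp add: s_def abs_square_less_1)
    have "\<bar>bump P k y\<bar> = \<bar>poly P y\<bar> * (exp (- 1 / s) / s ^ k)"
      using y s by (simp add: bump_def s_def abs_mult)
    also have "\<dots> = \<bar>poly P y\<bar> * (exp (- 1 / s) / s ^ (k + m)) * s ^ m"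
      using s by (simp add: power_add)
    also have "\<dots> \<le> M * fact (k + m) * s ^ m"
      using exp_inverse_power_bound[OF s, of "k + m"] M(2)[of y] y s M(1)
      by (intro mult_right_mono mult_mono) auto
    finally show "\<bar>bump P k y\<bar> \<le> M * fact (k + m) * (1 - y\<^sup>2) ^ m" by (simp add: s_def)
  qed (use M in simp)
qed

lemma bump_bounded:
  obtains C where "\<And>y. \<bar>bump P k y\<bar> \<le> C"
proof -
  obtain C where "0 \<le> C" "\<And>y. \<bar>y\<bar> < 1 \<Longrightarrow> \<bar>bump P k y\<bar> \<le> C * (1 - y\<^sup>2) ^ 0"
    using bump_decay by blast
  then show ?thesis by (intro that[of C]) (auto simp: bump_def)
qed

lemma has_derivative_zero_of_quadratic_bound:
  fixes f :: "real \<Rightarrow> real"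
  assumes "\<And>y. \<bar>f y - f a\<bar> \<le> C * (y - a)\<^sup>2"
  shows "(f has_real_derivative 0) (at a)"
  unfolding has_field_derivative_iff
proof (rule Lim_null_comparison[of _ "\<lambda>y. C * \<bar>y - a\<bar>"])
  have "\<bar>(f y - f a) / (y - a)\<bar> \<le> C * \<bar>y - a\<bar>" if "y \<noteq> a" for y
    using assms[of y] that by (simp add: abs_divide divide_le_eq power2_eq_square mult.assoc)
  then show "\<forall>\<^sub>F y in at a. norm ((f y - f a) / (y - a)) \<le> C * \<bar>y - a\<bar>"
    by (auto simp: eventually_at_filter)
  have "((\<lambda>y. C * \<bar>y - a\<bar>) \<longlongrightarrow> C * \<bar>a - a\<bar>) (at a)" by (intro tendsto_intros)
  then show "((\<lambda>y. C * \<bar>y - a\<bar>) \<longlongrightarrow> 0) (at a)" by simp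
qed

text \<open>
  Inside the interval this is the product rule and outside both sides are \<open>0\<close>; at \<open>\<plusminus>1\<close> the decay of
  order \<open>s\<^sup>2\<close>, where \<open>s\<close> is at most twice the distance from the end point, forces the derivative
  to be \<open>0\<close>.
\<close>
lemma bump_has_derivative:
  "(bump P k has_real_derivative bump (bump_diff P k) (k + 2) y) (at y)"
proof -
  consider "\<bar>y\<bar> < 1" | "\<bar>y\<bar> > 1" | "\<bar>y\<bar> = 1" by linarith
  then show ?thesis
  proof cases
    case 1
    define s where "s = 1 - y\<^sup>2"
    have s: "s > 0" using 1 by (simp add: s_def abs_square_less_1)
    define i where "i = (\<lambda>y::real. 1 / (1 - y\<^sup>2))"
    have i': "(i has_real_derivative 2 * y * (i y)\<^sup>2) (at y)"
      using s unfolding i_def s_def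
      by (auto intro!: derivative_eq_intros simp: field_simps power2_eq_square)
    have "((\<lambda>y. i y ^ k) has_real_derivative 2 * real k * y * i y ^ (k + 1)) (at y)"
      by (rule DERIV_cong[OF DERIV_power[OF i']]) (cases k; simp add: power2_eq_square)
    from DERIV_mult[OF DERIV_mult[OF poly_DERIV this] DERIV_fun_exp[OF DERIV_minus[OF i']]]
    have "((\<lambda>y. poly P y * i y ^ k * exp (- i y)) has_real_derivative
        (poly (pderiv P) y * i y ^ k + 2 * real k * y * poly P y * i y ^ (k + 1)
          - 2 * y * poly P y * i y ^ (k + 2)) * exp (- i y)) (at y)"
      by (rule DERIV_cong) (simp add: algebra_simps power2_eq_square)
    then have "((\<lambda>y. poly P y / (1 - y\<^sup>2) ^ k * exp (- 1 / (1 - y\<^sup>2))) has_real_derivative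
        (poly (pderiv P) y / s ^ k + 2 * real k * y * poly P y / s ^ (k + 1)
          - 2 * y * poly P y / s ^ (k + 2)) * exp (- 1 / s)) (at y)"
      by (simp add: i_def s_def power_divide)
    also have "(poly (pderiv P) y / s ^ k + 2 * real k * y * poly P y / s ^ (k + 1)
          - 2 * y * poly P y / s ^ (k + 2)) * exp (- 1 / s) = bump (bump_diff P k) (k + 2) y"
    proof -
      have "poly (bump_diff P k) y
          = poly (pderiv P) y * s\<^sup>2 + 2 * real k * y * poly P y * s - 2 * y * poly P y"
        by (simp add: bump_diff_def s_def power2_eq_square algebra_simps)
      then show ?thesis
        using 1 s by (simp add: bump_def flip: s_def) (simp add: field_simps power2_eq_square)
    qed
    finally show ?thesis
      by (rule has_field_derivative_transform_within_open[of _ _ _ "{-1<..<1}"])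
         (use 1 in \<open>auto simp: bump_def\<close>)
  next
    case 2
    have "((\<lambda>_. 0) has_real_derivative 0) (at y)" by simp
    then have "(bump P k has_real_derivative 0) (at y)"
      by (rule has_field_derivative_transform_within_open[of _ _ _ "- {-1..1}"])
         (use 2 in \<open>auto simp: bump_def\<close>)
    then show ?thesis using 2 by (simp add: bump_def)
  next
    case 3
    obtain C where C: "0 \<le> C" "\<And>z. \<bar>z\<bar> < 1 \<Longrightarrow> \<bar>bump P k z\<bar> \<le> C * (1 - z\<^sup>2) ^ 2"
      using bump_decay by blast
    have "\<bar>bump P k z - bump P k y\<bar> \<le> (4 * C) * (z - y)\<^sup>2" for z
    proof (cases "\<bar>z\<bar> < 1")
      case True
      have "1 - z\<^sup>2 = (y - z) * (y + z)" using 3 by (auto simp: algebra_simps power2_eq_square abs_if split: if_splits)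
      then have "(1 - z\<^sup>2) ^ 2 = (z - y)\<^sup>2 * (y + z)\<^sup>2" by (simp add: power_mult_distrib power2_commute)
      also have "\<dots> \<le> (z - y)\<^sup>2 * 2\<^sup>2"
        using True 3 by (intro mult_left_mono abs_le_square_iff[THEN iffD1]) auto
      finally have "C * (1 - z\<^sup>2) ^ 2 \<le> C * ((z - y)\<^sup>2 * 4)" using C by (intro mult_left_mono) auto
      then show ?thesis using C(2)[OF True] 3 by (simp add: bump_def[of P k y])
    qed (use 3 C in \<open>simp add: bump_def\<close>)
    then have "(bump P k has_real_derivative 0) (at y)"
      by (rule has_derivative_zero_of_quadratic_bound)
    then show ?thesis using 3 by (simp add: bump_def)
  qed
qed

lemma rescaled_bump_has_derivative:
  "((\<lambda>x. bump P k (x / R)) has_real_derivative bump (bump_diff P k) (k + 2) (x / R) / R) (at x)"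
  by (rule DERIV_cong[OF DERIV_chain2[OF bump_has_derivative DERIV_cdivide[OF DERIV_ident]]]) simp

text \<open>
  The factor \<open>1 / R\<close> from the chain rule goes into the polynomial, so dilated bumps are
  again closed under differentiation.
\<close>
lemma rescaled_bump_deriv:
  "deriv (\<lambda>x. bump P k (x / R)) = (\<lambda>x. bump (smult (1 / R) (bump_diff P k)) (k + 2) (x / R))"
  by (rule ext, rule DERIV_imp_deriv, rule DERIV_cong[OF rescaled_bump_has_derivative])
     (simp add: bump_def)

lemma rescaled_bump_test_form:
  assumes "0 < R"
  shows "(\<lambda>x. bump P k (x / R)) \<in> test_forms 0 UNIV"
proof -
  have "\<exists>Q l. (deriv ^^ m) (\<lambda>x. bump P k (x / R)) = (\<lambda>x. bump Q l (x / R))" for m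
  proof (induction m)
    case (Suc m)
    then obtain Q l where "(deriv ^^ m) (\<lambda>x. bump P k (x / R)) = (\<lambda>x. bump Q l (x / R))" by blast
    then have "(deriv ^^ Suc m) (\<lambda>x. bump P k (x / R))
        = (\<lambda>x. bump (smult (1 / R) (bump_diff Q l)) (l + 2) (x / R))"
      by (simp add: rescaled_bump_deriv)
    then show ?case by blast
  qed auto
  moreover have "(\<lambda>x. bump Q l (x / R)) differentiable_on UNIV" for Q l
    using rescaled_bump_has_derivative
    by (meson differentiable_at_withinI differentiable_on_def real_differentiable_def)
  ultimately have "(deriv ^^ m) (\<lambda>x. bump P k (x / R)) differentiable_on UNIV" for m
    by metis
  moreover have "{x. bump P k (x / R) \<noteq> 0} \<subseteq> {-R..R}"
    using assms by (auto simp: bump_def field_simps abs_less_iff split: if_splits)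
  then have "compact (closure {x. bump P k (x / R) \<noteq> 0})"
    using bounded_subset[OF bounded_closed_interval] by (subst compact_closure) 
  ultimately show ?thesis by (simp add: test_forms_def forms_def)
qed

section \<open>The indicator of the unit interval as a limit of exact forms\<close>

text \<open>
  Slope \<open>1\<close> from \<open>0\<close> up to height \<open>1\<close>, then slope \<open>- 1 / L\<close> back to \<open>0\<close>.
\<close>
definition tent :: "real \<Rightarrow> form" where
  "tent L x = max 0 (min x (1 - (x - 1) / L))"

definition tent_diff :: "real \<Rightarrow> form" where
  "tent_diff L x = indicator {0..1} x - indicator {1<..1 + L} x / L"

lemma tent_has_derivative:
  assumes "0 < L" "x \<notin> {0, 1, 1 + L}"
  shows "(tent L has_real_derivative tent_diff L x) (at x)"
proof -
  consider "x < 0" | "0 < x" "x < 1" | "1 < x" "x < 1 + L" | "1 + L < x"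
    using assms by force
  then show ?thesis
  proof cases
    case 1
    have "((\<lambda>_. 0) has_real_derivative tent_diff L x) (at x)"
      using 1 by (simp add: tent_diff_def)
    then show ?thesis
      by (rule has_field_derivative_transform_within_open[of _ _ _ "{..<0}"])
         (use 1 in \<open>auto simp: tent_def\<close>)
  next
    case 2
    have "((\<lambda>x. x) has_real_derivative tent_diff L x) (at x)"
      using 2 by (simp add: tent_diff_def)
    then show ?thesis
    proof (rule has_field_derivative_transform_within_open[of _ _ _ "{0<..<1}"])
      fix y :: real assume y: "y \<in> {0<..<1}"
      then have "0 \<le> (1 - y) / L" using assms by simp
      then have "y \<le> 1 - (y - 1) / L" using y by (simp add: diff_divide_distrib)
      then show "y = tent L y" using y by (simp add: tent_def)
    qed (use 2 in auto)
  next
    case 3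
    have "((\<lambda>x. 1 - (x - 1) / L) has_real_derivative tent_diff L x) (at x)"
      using 3 assms by (auto intro!: derivative_eq_intros simp: tent_diff_def)
    then show ?thesis
    proof (rule has_field_derivative_transform_within_open[of _ _ _ "{1<..<1 + L}"])
      fix y :: real assume y: "y \<in> {1<..<1 + L}"
      then have "(y - 1) / L \<le> 1" "0 \<le> (y - 1) / L" using assms by auto
      moreover from this y have "1 - (y - 1) / L \<le> y"
        unfolding greaterThanLessThan_iff by linarith
      ultimately show "1 - (y - 1) / L = tent L y" by (simp add: tent_def)
    qed (use 3 in auto)
  next
    case 4
    have "((\<lambda>_. 0) has_real_derivative tent_diff L x) (at x)"
      using 4 assms by (simp add: tent_diff_def)
    then show ?thesis
    proof (rule has_field_derivative_transform_within_open[of _ _ _ "{1 + L<..}"])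
      fix y :: real assume y: "y \<in> {1 + L<..}"
      then have "1 - (y - 1) / L \<le> 0" using assms by (simp add: field_simps)
      then show "0 = tent L y" by (simp add: tent_def)
    qed (use 4 in auto)
  qed
qed

lemma tent_in_orlicz_forms:
  assumes "N_function \<Phi>" "0 < L"
  shows "tent L \<in> orlicz_forms \<Phi> 0"
proof (rule orlicz_forms_bounded_support[OF assms(1), where C = 1 and a = 0 and b = "1 + L"])
  have "continuous_on UNIV (\<lambda>x. max 0 (min x (1 - (x - 1) / L)))"
    using assms by (intro continuous_intros) auto
  then show "tent L \<in> borel_measurable lebesgue"
    by (intro lebesgue_measurable_continuous) (simp add: tent_def[abs_def])
  fix x :: real
  have "min x (1 - (x - 1) / L) \<le> 1"
  proof (cases "x \<le> 1")
    case False
    then have "0 \<le> (x - 1) / L" using assms by simp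
    then show ?thesis by simp
  qed auto
  then show "\<bar>tent L x\<bar> \<le> 1" by (auto simp: tent_def)
  assume "x \<notin> {0..1 + L}"
  then have "x < 0 \<or> 1 - (x - 1) / L \<le> 0" using assms by (auto simp: field_simps)
  then show "tent L x = 0" by (auto simp: tent_def)
qed simp

lemma tent_diff_measurable: "tent_diff L \<in> borel_measurable lebesgue"
proof -
  have "tent_diff L \<in> borel_measurable borel" unfolding tent_diff_def[abs_def] by measurable
  then show ?thesis by (intro measurable_completion) simp
qed

lemma tent_diff_bound:
  assumes "0 < L" shows "\<bar>tent_diff L x\<bar> \<le> 1 + 1 / L"
  using assms by (auto simp: tent_diff_def indicator_def)

lemma tent_diff_exact:
  assumes "N_function \<Phi>\<^sub>1" "N_function \<Phi>\<^sub>2" "0 < L"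
  shows "tent_diff L \<in> exact_forms \<Phi>\<^sub>1 \<Phi>\<^sub>2 1"
proof -
  have "weak_diff 0 (tent L) (tent_diff L)"
  proof (rule weak_diff_of_piecewise_derivative[of "{0, 1, 1 + L}"])
    have "continuous_on UNIV (\<lambda>x. max 0 (min x (1 - (x - 1) / L)))"
      using assms by (intro continuous_intros) auto
    then show "continuous_on UNIV (tent L)" by (simp add: tent_def[abs_def])
    show "locally_integrable (tent_diff L)"
      by (rule locally_integrable_bounded[OF tent_diff_measurable tent_diff_bound[OF assms(3)]])
  qed (use tent_has_derivative[OF assms(3)] in auto)
  moreover have "tent_diff L \<in> orlicz_forms \<Phi>\<^sub>2 1"
    by (rule orlicz_forms_bounded_support[OF assms(2) tent_diff_measurable _
          tent_diff_bound[OF assms(3)], of _ 0 "1 + L"])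
       (use assms in \<open>auto simp: tent_diff_def\<close>)
  ultimately show ?thesis
    using tent_in_orlicz_forms[OF assms(1,3)] by (auto simp: exact_forms_def)
qed

text \<open>
  The difference is \<open>1 / L\<close> on an interval of length \<open>L\<close>.  With \<open>y = 1 / (L \<epsilon>)\<close> the
  modular of its quotient by \<open>\<epsilon>\<close> is \<open>\<Phi> y * L = (\<Phi> y / y) / \<epsilon>\<close>, which is at most \<open>1\<close> for small \<open>y\<close>
  because \<open>\<Phi> y / y \<rightarrow> 0\<close>.
\<close>
lemma tent_diff_approximates:
  assumes "N_function \<Phi>" "0 < \<epsilon>"
  shows "\<exists>L>0. gauge_norm \<Phi> (\<lambda>x. indicator {0..1} x - tent_diff L x) \<le> \<epsilon>"
proof -
  have "((\<lambda>x. \<Phi> x / x) \<longlongrightarrow> 0) (at 0)" using assms by (simp add: N_function_def)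
  then obtain \<delta> where \<delta>: "\<delta> > 0" "\<And>y. y \<noteq> 0 \<Longrightarrow> \<bar>y\<bar> < \<delta> \<Longrightarrow> \<bar>\<Phi> y / y\<bar> < \<epsilon>"
    using assms(2) by (auto simp: LIM_def)
  define y L where "y = \<delta> / 2" and "L = 1 / (\<epsilon> * y)"
  have y: "y > 0" and L: "L > 0" using \<delta> assms by (auto simp: y_def L_def)
  have "\<bar>\<Phi> y / y\<bar> < \<epsilon>" by (rule \<delta>(2)) (use \<delta>(1) in \<open>auto simp: y_def\<close>)
  then have "\<Phi> y / y < \<epsilon>" by linarith
  then have small: "\<Phi> y * L \<le> 1" using y assms by (simp add: L_def field_simps)
  have "modular \<Phi> (\<lambda>x. (indicator {0..1} x - tent_diff L x) / \<epsilon>)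
      = (\<integral>\<^sup>+x. ennreal (\<Phi> y) * indicator {1<..1 + L} x \<partial>lebesgue)"
    unfolding modular_def
    by (rule nn_integral_cong)
       (use y L assms in \<open>auto simp: tent_diff_def indicator_def N_function_zero L_def\<close>)
  also have "\<dots> = ennreal (\<Phi> y) * ennreal L"
    using L by (subst nn_integral_cmult_indicator) auto
  also have "\<dots> \<le> 1"
    using small L N_function_nonneg[OF assms(1), of y] by (simp flip: ennreal_mult)
  finally show ?thesis using L assms by (auto intro!: gauge_norm_le)
qed

section \<open>The indicator of the unit interval is not exact\<close>

text \<open>
  For \<open>c\<close> of order \<open>1 / R\<close> the right-hand side is \<open>O(\<epsilon>) + O(1 / R)\<close>: means of an Orlicz function
  over growing intervals tend to \<open>0\<close>.
\<close>
lemma orlicz_pairing_bound: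
  assumes "N_function \<Phi>" "\<beta> \<in> borel_measurable lebesgue" "0 < \<alpha>" "0 \<le> M"
    and "modular \<Phi> (\<lambda>x. \<alpha> * \<beta> x) = ennreal M"
    and "v \<in> borel_measurable lebesgue" "\<And>x. \<bar>v x\<bar> \<le> c" "\<And>x. x \<notin> {- R..R} \<Longrightarrow> v x = 0"
    and "0 < R" "0 < \<epsilon>"
  shows "\<alpha> * \<bar>LINT x|lebesgue. \<beta> x * v x\<bar> \<le> 2 * R * c * \<epsilon> + \<epsilon> / \<Phi> \<epsilon> * c * M"
proof -
  have [measurable]: "\<Phi> \<in> borel_measurable borel" "\<beta> \<in> borel_measurable lebesgue"
      "v \<in> borel_measurable lebesgue"
    using assms N_function_borel by auto
  have c: "0 \<le> c" using assms(7)[of 0] by linarith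
  have \<Phi>int: "integrable lebesgue (\<lambda>x. \<Phi> \<bar>\<alpha> * \<beta> x\<bar>)" "(LINT x|lebesgue. \<Phi> \<bar>\<alpha> * \<beta> x\<bar>) = M"
    using nn_integral_eq_integrable[of "\<lambda>x. \<Phi> \<bar>\<alpha> * \<beta> x\<bar>" lebesgue M] assms
    by (auto simp: modular_def N_function_nonneg)
  define g where "g = (\<lambda>x. c * \<epsilon> * indicat_real {- R..R} x + \<epsilon> / \<Phi> \<epsilon> * c * \<Phi> \<bar>\<alpha> * \<beta> x\<bar>)"
  have ind: "integrable lebesgue (indicat_real {- R..R})"
    by (rule integrable_real_indicator) (auto simp: emeasure_lborel_Icc_eq)
  have g: "integrable lebesgue g" unfolding g_def
    by (intro Bochner_Integration.integrable_add integrable_mult_right ind \<Phi>int)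
  have le: "\<bar>\<alpha> * (\<beta> x * v x)\<bar> \<le> g x" for x
  proof (cases "x \<in> {- R..R}")
    case True
    have "\<bar>\<alpha> * (\<beta> x * v x)\<bar> = \<bar>\<alpha> * \<beta> x\<bar> * \<bar>v x\<bar>" by (simp add: abs_mult)
    also have "\<dots> \<le> (\<epsilon> + \<epsilon> / \<Phi> \<epsilon> * \<Phi> \<bar>\<alpha> * \<beta> x\<bar>) * c"
      using N_function_linear_bound[OF assms(1,10), of "\<bar>\<alpha> * \<beta> x\<bar>"] assms(7)[of x]
      by (intro mult_mono') auto
    also have "\<dots> = g x" using True by (simp add: g_def algebra_simps)
    finally show ?thesis .
  next
    case False
    then show ?thesis using assms(8)[OF False] c assms(1,10)
      by (simp add: g_def N_function_nonneg)
  qed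
  have int: "integrable lebesgue (\<lambda>x. \<alpha> * (\<beta> x * v x))"
  proof (rule Bochner_Integration.integrable_bound[OF g])
    have "norm (\<alpha> * (\<beta> x * v x)) \<le> norm (g x)" for x using le[of x] by simp
    then show "AE x in lebesgue. norm (\<alpha> * (\<beta> x * v x)) \<le> norm (g x)" by simp
  qed measurable
  have "\<alpha> * \<bar>LINT x|lebesgue. \<beta> x * v x\<bar> = \<bar>LINT x|lebesgue. \<alpha> * (\<beta> x * v x)\<bar>"
    using assms by (simp add: abs_mult)
  also have "\<dots> \<le> (LINT x|lebesgue. g x)"
    using Bochner_Integration.integral_norm_bound_integral[OF int g] le by simp
  also have "\<dots> = c * \<epsilon> * (2 * R) + \<epsilon> / \<Phi> \<epsilon> * c * M"
    unfolding g_def using ind \<Phi>int assms by simp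
  finally show ?thesis by (simp add: mult_ac)
qed

text \<open>
  Pairing with a dilated bump leads to \<open>q \<le> 2 C \<epsilon> + D / R\<close>, where \<open>q\<close> is a fixed positive lower bound
  coming from \<open>[0,1]\<close> and \<open>C\<close> bounds the derivative of the undilated bump; choosing first
  \<open>\<epsilon>\<close> and then \<open>R\<close> makes each term on the right less than or equal to \<open>q / 2\<close>, and the second strictly less.
\<close>
lemma indicator_not_exact:
  assumes "N_function \<Phi>\<^sub>1"
  shows "indicator {0..1} \<notin> exact_forms \<Phi>\<^sub>1 \<Phi>\<^sub>2 1"
proof
  assume "indicator {0..1} \<in> exact_forms \<Phi>\<^sub>1 \<Phi>\<^sub>2 1"
  then obtain \<beta> where \<beta>: "\<beta> \<in> orlicz_forms \<Phi>\<^sub>1 0" "weak_diff 0 \<beta> (indicator {0..1})"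
    by (auto simp: exact_forms_def)
  obtain \<alpha> where \<alpha>: "\<alpha> > 0" "modular \<Phi>\<^sub>1 (\<lambda>x. \<alpha> * \<beta> x) < \<infinity>"
    using \<beta>(1) by (auto simp: orlicz_forms_def)
  then obtain M where M: "0 \<le> M" "modular \<Phi>\<^sub>1 (\<lambda>x. \<alpha> * \<beta> x) = ennreal M"
    by (metis ennreal_cases infinity_ennreal_def less_irrefl)
  obtain C where C: "\<And>y. \<bar>bump (bump_diff 1 0) (0 + 2) y\<bar> \<le> C" using bump_bounded by blast
  then have C0: "0 \<le> C" by (meson abs_ge_zero order_trans)
  define q where "q = \<alpha> * exp (- 2)"
  define \<epsilon> where "\<epsilon> = q / (4 * (C + 1))"
  define D where "D = \<epsilon> / \<Phi>\<^sub>1 \<epsilon> * C * M"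
  define R where "R = 2 + 2 * D / q"
  have q: "q > 0" using \<alpha> by (simp add: q_def)
  have \<epsilon>: "\<epsilon> > 0" using q C0 by (simp add: \<epsilon>_def)
  have D: "D \<ge> 0" using \<epsilon> C0 M N_function_nonneg[OF assms] by (simp add: D_def)
  have R: "R \<ge> 2" using D q by (simp add: R_def)
  define u where "u = (\<lambda>x. bump 1 0 (x / R))"
  have u: "u \<in> test_forms 0 UNIV" unfolding u_def by (rule rescaled_bump_test_form) (use R in simp)
  have u': "deriv u = (\<lambda>x. bump (bump_diff 1 0) (0 + 2) (x / R) / R)"
    unfolding u_def by (rule ext, rule DERIV_imp_deriv, rule rescaled_bump_has_derivative)
  have pair: "(LINT x|lebesgue. \<beta> x * deriv u x) = - (LINT x|lebesgue. indicator {0..1} x * u x)"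
    and li: "locally_integrable (indicator {0..1})"
    using \<beta>(2) u unfolding weak_diff_0_iff by blast+
  \<comment> \<open>For \<open>R \<ge> 2\<close> the unit interval lies where \<open>\<bar>x / R\<bar> \<le> 1 / 2\<close>, on which the bump is at least \<open>exp (- 2)\<close>.\<close>
  have "exp (- 2) = (LINT x|lebesgue. indicat_real {0..1::real} x * exp (- 2))" by simp
  also have "\<dots> \<le> (LINT x|lebesgue. indicator {0..1} x * u x)"
  proof (rule integral_mono)
    show "integrable lebesgue (\<lambda>x. indicat_real {0..1::real} x * exp (- 2))"
      by (intro integrable_mult_left integrable_real_indicator) auto
    show "integrable lebesgue (\<lambda>x. indicat_real {0..1} x * u x)"
      by (rule test_form_mult_integrable[OF li u])
    fix x :: real
    have "exp (- 2) \<le> u x" if x: "x \<in> {0..1}"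
    proof -
      have y: "0 \<le> x / R" "x / R \<le> 1 / 2" using x R by (auto simp: field_simps)
      have "(x / R)\<^sup>2 \<le> (1 / 2)\<^sup>2" by (rule power_mono[OF y(2,1)])
      moreover have "(1 / 2 :: real)\<^sup>2 \<le> 1 / 2" by (simp add: power2_eq_square)
      ultimately have "1 / 2 \<le> 1 - (x / R)\<^sup>2" by linarith
      then have "1 / (1 - (x / R)\<^sup>2) \<le> 1 / (1 / 2)" by (intro divide_left_mono) auto
      then have "exp (- 2) \<le> exp (- 1 / (1 - (x / R)\<^sup>2))" by simp
      also have "\<dots> = u x"
      proof -
        have "\<bar>x / R\<bar> < 1" using y by linarith
        then show ?thesis by (simp add: u_def bump_def)
      qed
      finally show ?thesis .
    qed
    then show "indicat_real {0..1} x * exp (- 2) \<le> indicat_real {0..1} x * u x"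
      by (cases "x \<in> {0..1}") auto
  qed
  finally have "q \<le> \<alpha> * \<bar>LINT x|lebesgue. \<beta> x * deriv u x\<bar>"
    unfolding q_def pair using \<alpha> by (intro mult_left_mono) auto
  also have "\<dots> \<le> 2 * R * (C / R) * \<epsilon> + \<epsilon> / \<Phi>\<^sub>1 \<epsilon> * (C / R) * M"
  proof (rule orlicz_pairing_bound[OF assms _ \<alpha>(1) M])
    show "\<beta> \<in> borel_measurable lebesgue" using \<beta>(1) by (rule orlicz_forms_measurable)
    show "deriv u \<in> borel_measurable lebesgue"
      by (intro lebesgue_measurable_continuous test_form_continuous[OF u])
    fix x
    show "\<bar>deriv u x\<bar> \<le> C / R" using C[of "x / R"] R by (simp add: u' divide_right_mono)
    assume "x \<notin> {- R..R}"
    then have "\<not> \<bar>x / R\<bar> < 1" using R by (auto simp: field_simps abs_less_iff)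
    then show "deriv u x = 0" unfolding u' bump_def by simp
  qed (use R \<epsilon> in auto)
  also have "\<dots> = 2 * C * \<epsilon> + D / R" using R by (simp add: D_def)
  also have "\<dots> < q / 2 + q / 2"
  proof (rule add_le_less_mono)
    have "q * C \<le> q * (C + 1)" using q by simp
    then show "2 * C * \<epsilon> \<le> q / 2" using C0 by (simp add: \<epsilon>_def field_simps)
    have "R * q = 2 * q + 2 * D" using q by (simp add: R_def field_simps)
    then have "D < q / 2 * R" using q by (simp add: field_simps)
    then show "D / R < q / 2" using R by (simp add: divide_less_eq)
  qed
  finally show False by simp
qed

section \<open>The topology of the cohomology\<close>

text \<open>
  Test forms for the differential of a \<open>1\<close>-form have degree \<open>- 1\<close>, hence vanish, so
  the weak equation \<open>d \<omega> = 0\<close> reduces to local integrability.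
\<close>
lemma closed_forms_1_iff:
  "\<omega> \<in> closed_forms \<Phi> 1 \<longleftrightarrow> \<omega> \<in> orlicz_forms \<Phi> 1 \<and> locally_integrable \<omega>"
proof -
  have "locally_integrable (\<lambda>_. 0)" by (simp add: locally_integrable_def set_integrable_def)
  moreover have "u x = 0" if "u \<in> test_forms (- 1) U" for u U x
    using that by (simp add: test_forms_def forms_def)
  ultimately show ?thesis
    by (auto simp: closed_forms_def weak_diff_def forms_def ext_deriv_def set_lebesgue_integral_def)
qed

lemma exact_forms_1_iff:
  "\<omega> \<in> exact_forms \<Phi>\<^sub>1 \<Phi>\<^sub>2 1 \<longleftrightarrow>
     \<omega> \<in> orlicz_forms \<Phi>\<^sub>2 1 \<and> (\<exists>\<beta> \<in> orlicz_forms \<Phi>\<^sub>1 0. weak_diff 0 \<beta> \<omega>)"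
  by (simp add: exact_forms_def)

lemma exact_forms_imp_closed:
  "\<omega> \<in> exact_forms \<Phi>\<^sub>1 \<Phi>\<^sub>2 1 \<Longrightarrow> \<omega> \<in> closed_forms \<Phi>\<^sub>2 1"
  by (auto simp: exact_forms_1_iff closed_forms_1_iff weak_diff_0_iff)

lemma closed_forms_diff:
  "N_function \<Phi> \<Longrightarrow> f \<in> closed_forms \<Phi> 1 \<Longrightarrow> g \<in> closed_forms \<Phi> 1 \<Longrightarrow>
     (\<lambda>x. f x - g x) \<in> closed_forms \<Phi> 1"
  by (auto simp: closed_forms_1_iff intro: orlicz_forms_diff locally_integrable_diff)

lemma exact_forms_diff:
  assumes "N_function \<Phi>\<^sub>1" "N_function \<Phi>\<^sub>2"
    and "f \<in> exact_forms \<Phi>\<^sub>1 \<Phi>\<^sub>2 1" "g \<in> exact_forms \<Phi>\<^sub>1 \<Phi>\<^sub>2 1"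
  shows "(\<lambda>x. f x - g x) \<in> exact_forms \<Phi>\<^sub>1 \<Phi>\<^sub>2 1"
proof -
  obtain \<beta> \<gamma> where "\<beta> \<in> orlicz_forms \<Phi>\<^sub>1 0" "weak_diff 0 \<beta> f" "\<gamma> \<in> orlicz_forms \<Phi>\<^sub>1 0" "weak_diff 0 \<gamma> g"
    using assms by (auto simp: exact_forms_1_iff)
  then have "(\<lambda>x. \<beta> x - \<gamma> x) \<in> orlicz_forms \<Phi>\<^sub>1 0" "weak_diff 0 (\<lambda>x. \<beta> x - \<gamma> x) (\<lambda>x. f x - g x)"
    by (auto intro: orlicz_forms_diff weak_diff_0_diff assms)
  then show ?thesis
    using assms by (auto simp: exact_forms_1_iff intro: orlicz_forms_diff)
qed

lemma zero_exact:
  assumes "N_function \<Phi>\<^sub>1" "N_function \<Phi>\<^sub>2"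
  shows "(\<lambda>_. 0) \<in> exact_forms \<Phi>\<^sub>1 \<Phi>\<^sub>2 1"
  using exact_forms_diff[OF assms tent_diff_exact tent_diff_exact, OF assms, of 1 1] assms by simp

lemma cohomology_class_eq:
  assumes "\<omega> \<in> closed_forms \<Phi>\<^sub>2 1"
  shows "cohomologous \<Phi>\<^sub>1 \<Phi>\<^sub>2 1 `` {\<omega>}
    = {\<eta> \<in> closed_forms \<Phi>\<^sub>2 1. (\<lambda>x. \<omega> x - \<eta> x) \<in> exact_forms \<Phi>\<^sub>1 \<Phi>\<^sub>2 1}"
  using assms by (auto simp: cohomologous_def)

text \<open>
  A representative \<open>x\<close> of a difference of classes may be replaced by \<open>(\<omega> - \<theta>) + x\<close> with \<open>\<theta>\<close> exact: this
  moves the first class from that of \<open>0\<close> to that of \<open>\<omega>\<close> and raises the norm by at most \<open>\<epsilon>\<close>.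
\<close>
lemma quotient_seminorm_limit_of_exact:
  assumes "N_function \<Phi>\<^sub>1" "N_function \<Phi>\<^sub>2" and \<omega>: "\<omega> \<in> closed_forms \<Phi>\<^sub>2 1"
    and approx: "\<And>\<epsilon>. 0 < \<epsilon> \<Longrightarrow>
      \<exists>\<theta> \<in> exact_forms \<Phi>\<^sub>1 \<Phi>\<^sub>2 1. gauge_norm \<Phi>\<^sub>2 (\<lambda>x. \<omega> x - \<theta> x) \<le> \<epsilon>"
    and d: "d \<subseteq> closed_forms \<Phi>\<^sub>2 1" "d \<noteq> {}"
  shows "quotient_seminorm \<Phi>\<^sub>2 (coset_diff (cohomologous \<Phi>\<^sub>1 \<Phi>\<^sub>2 1 `` {\<omega>}) d)
       \<le> quotient_seminorm \<Phi>\<^sub>2 (coset_diff (cohomologous \<Phi>\<^sub>1 \<Phi>\<^sub>2 1 `` {\<lambda>_. 0}) d)"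
    (is "quotient_seminorm _ ?Y \<le> quotient_seminorm _ ?X")
  unfolding quotient_seminorm_def
proof (rule cINF_greatest)
  note ediff = exact_forms_diff[OF assms(1,2)] and cdiff = closed_forms_diff[OF assms(2)]
  have zero: "(\<lambda>_. 0) \<in> exact_forms \<Phi>\<^sub>1 \<Phi>\<^sub>2 1" by (rule zero_exact[OF assms(1,2)])
  note class0 = cohomology_class_eq[OF exact_forms_imp_closed[OF zero], of \<Phi>\<^sub>1]
  note class\<omega> = cohomology_class_eq[OF \<omega>, of \<Phi>\<^sub>1]
  show "?X \<noteq> {}"
    using d zero exact_forms_imp_closed[OF zero] by (auto simp: coset_diff_def class0)
  have bdd: "bdd_below (gauge_norm \<Phi>\<^sub>2 ` ?Y)"
  proof (rule bdd_belowI2[of _ 0])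
    fix y assume "y \<in> ?Y"
    then have "y \<in> closed_forms \<Phi>\<^sub>2 1"
      using d cdiff unfolding coset_diff_def class\<omega> by blast
    then show "0 \<le> gauge_norm \<Phi>\<^sub>2 y"
      using gauge_norm_nonneg[OF assms(2)] by (auto simp: closed_forms_1_iff)
  qed
  fix x assume "x \<in> ?X"
  then obtain e \<eta> where e: "e \<in> closed_forms \<Phi>\<^sub>2 1" "(\<lambda>x. 0 - e x) \<in> exact_forms \<Phi>\<^sub>1 \<Phi>\<^sub>2 1"
    and \<eta>: "\<eta> \<in> d" and x: "x = (\<lambda>t. e t - \<eta> t)"
    unfolding coset_diff_def class0 by blast
  have xc: "x \<in> closed_forms \<Phi>\<^sub>2 1" unfolding x using e \<eta> d by (intro cdiff) auto
  show "(INF y\<in>?Y. gauge_norm \<Phi>\<^sub>2 y) \<le> gauge_norm \<Phi>\<^sub>2 x"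
  proof (rule field_le_epsilon)
    fix \<epsilon> :: real assume "0 < \<epsilon>"
    then obtain \<theta> where \<theta>: "\<theta> \<in> exact_forms \<Phi>\<^sub>1 \<Phi>\<^sub>2 1" "gauge_norm \<Phi>\<^sub>2 (\<lambda>x. \<omega> x - \<theta> x) \<le> \<epsilon>"
      using approx by blast
    define z where "z = (\<lambda>t. (\<omega> t - \<theta> t) - (0 - e t))"
    have r: "(\<lambda>t. \<omega> t - \<theta> t) \<in> closed_forms \<Phi>\<^sub>2 1"
      by (intro cdiff \<omega> exact_forms_imp_closed[OF \<theta>(1)])
    have "z \<in> closed_forms \<Phi>\<^sub>2 1"
      unfolding z_def by (intro cdiff[OF r] exact_forms_imp_closed[OF e(2)])
    moreover have "(\<lambda>t. \<omega> t - z t) \<in> exact_forms \<Phi>\<^sub>1 \<Phi>\<^sub>2 1"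
    proof -
      have "(\<lambda>t. \<theta> t - (0 - (0 - e t))) \<in> exact_forms \<Phi>\<^sub>1 \<Phi>\<^sub>2 1"
        by (rule ediff[OF \<theta>(1) ediff[OF zero e(2)]])
      then show ?thesis by (simp add: z_def)
    qed
    ultimately have "(\<lambda>t. z t - \<eta> t) \<in> ?Y" using \<eta> unfolding coset_diff_def class\<omega> by blast
    then have "(INF y\<in>?Y. gauge_norm \<Phi>\<^sub>2 y) \<le> gauge_norm \<Phi>\<^sub>2 (\<lambda>t. z t - \<eta> t)"
      by (rule cINF_lower[OF bdd])
    also have "(\<lambda>t. z t - \<eta> t) = (\<lambda>t. (\<omega> t - \<theta> t) + x t)"
      by (simp add: z_def x fun_eq_iff)
    also have "gauge_norm \<Phi>\<^sub>2 \<dots> \<le> gauge_norm \<Phi>\<^sub>2 (\<lambda>t. \<omega> t - \<theta> t) + gauge_norm \<Phi>\<^sub>2 x"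
      using r xc by (intro gauge_norm_triangle[OF assms(2)]) (auto simp: closed_forms_1_iff)
    finally show "(INF y\<in>?Y. gauge_norm \<Phi>\<^sub>2 y) \<le> gauge_norm \<Phi>\<^sub>2 x + \<epsilon>" using \<theta>(2) by linarith
  qed
qed

text \<open>
  Finite intersections and unions inherit from the generating sets that membership of \<open>x\<close>
  implies membership of \<open>y\<close>, so no open set separates \<open>x\<close> from \<open>y\<close>.
\<close>
lemma not_Hausdorff_topology_generated_by:
  assumes "x \<in> \<Union>S" "y \<in> \<Union>S" "x \<noteq> y"
    and basis: "\<And>B. B \<in> S \<Longrightarrow> x \<in> B \<Longrightarrow> y \<in> B"
  shows "\<not> Hausdorff_space (topology_generated_by S)"
proof
  assume "Hausdorff_space (topology_generated_by S)"
  then obtain U V where UV: "openin (topology_generated_by S) U" "x \<in> U" "y \<in> V" "disjnt U V"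
    using assms unfolding Hausdorff_space_def topology_generated_by_topspace by metis
  have "generate_topology_on S U" using UV(1) by (simp add: openin_topology_generated_by_iff)
  then have "x \<in> U \<longrightarrow> y \<in> U"
    by induction (use basis in auto)
  then show False using UV by (auto simp: disjnt_def)
qed

theorem corollary4p2:
  fixes \<Phi>\<^sub>1 \<Phi>\<^sub>2 :: "real \<Rightarrow> real"
  assumes "N_function \<Phi>\<^sub>1" and "N_function \<Phi>\<^sub>2"
  shows "\<not> Hausdorff_space (cohomology_topology \<Phi>\<^sub>1 \<Phi>\<^sub>2 1) \<and>
         orlicz_cohomology \<Phi>\<^sub>1 \<Phi>\<^sub>2 1 \<noteq> {exact_forms \<Phi>\<^sub>1 \<Phi>\<^sub>2 1}"
proof -
  define H where "H = orlicz_cohomology \<Phi>\<^sub>1 \<Phi>\<^sub>2 1"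
  define cls where "cls = (\<lambda>\<omega>. cohomologous \<Phi>\<^sub>1 \<Phi>\<^sub>2 1 `` {\<omega>})"
  define \<omega> :: form where "\<omega> = indicator {0..1}"
  note zero = zero_exact[OF assms]
  have \<omega>: "\<omega> \<in> closed_forms \<Phi>\<^sub>2 1"
    unfolding closed_forms_1_iff
  proof
    have meas: "\<omega> \<in> borel_measurable lebesgue"
      unfolding \<omega>_def by (rule borel_measurable_indicator) simp
    show "\<omega> \<in> orlicz_forms \<Phi>\<^sub>2 1"
      by (rule orlicz_forms_bounded_support[OF assms(2) meas, where C = 1 and a = 0 and b = 1])
         (auto simp: \<omega>_def indicator_def)
    show "locally_integrable \<omega>"
      by (rule locally_integrable_bounded[OF meas, of 1]) (auto simp: \<omega>_def indicator_def)
  qed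
  have self: "\<eta> \<in> cls \<eta>" if "\<eta> \<in> closed_forms \<Phi>\<^sub>2 1" for \<eta>
    unfolding cls_def cohomology_class_eq[OF that] using that zero by simp
  have H: "cls \<eta> \<in> H" if "\<eta> \<in> closed_forms \<Phi>\<^sub>2 1" for \<eta>
    unfolding H_def cls_def orlicz_cohomology_def using that by (rule quotientI)
  have H_ne: "d \<subseteq> closed_forms \<Phi>\<^sub>2 1 \<and> d \<noteq> {}" if "d \<in> H" for d
  proof -
    obtain \<eta> where \<eta>: "\<eta> \<in> closed_forms \<Phi>\<^sub>2 1" "d = cls \<eta>"
      using \<open>d \<in> H\<close> unfolding H_def orlicz_cohomology_def cls_def by (blast elim: quotientE)
    then show ?thesis using self[OF \<eta>(1)] cohomology_class_eq[OF \<eta>(1), of \<Phi>\<^sub>1]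
      unfolding cls_def by blast
  qed
  have zero_closed: "(\<lambda>_. 0) \<in> closed_forms \<Phi>\<^sub>2 1" by (rule exact_forms_imp_closed[OF zero])
  have neq: "cls (\<lambda>_. 0) \<noteq> cls \<omega>"
  proof
    assume "cls (\<lambda>_. 0) = cls \<omega>"
    then have "\<omega> \<in> cls (\<lambda>_. 0)" using self[OF \<omega>] by simp
    then have "(\<lambda>x. 0 - \<omega> x) \<in> exact_forms \<Phi>\<^sub>1 \<Phi>\<^sub>2 1"
      unfolding cls_def cohomology_class_eq[OF zero_closed] by simp
    from exact_forms_diff[OF assms zero this] have "\<omega> \<in> exact_forms \<Phi>\<^sub>1 \<Phi>\<^sub>2 1" by simp
    then show False using indicator_not_exact[OF assms(1)] by (simp add: \<omega>_def)
  qed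
  have approx: "\<exists>\<theta> \<in> exact_forms \<Phi>\<^sub>1 \<Phi>\<^sub>2 1. gauge_norm \<Phi>\<^sub>2 (\<lambda>x. \<omega> x - \<theta> x) \<le> \<epsilon>"
    if "0 < \<epsilon>" for \<epsilon>
    using tent_diff_approximates[OF assms(2) that] tent_diff_exact[OF assms] unfolding \<omega>_def by blast
  have "\<not> Hausdorff_space (cohomology_topology \<Phi>\<^sub>1 \<Phi>\<^sub>2 1)"
    unfolding cohomology_topology_def
  proof (rule not_Hausdorff_topology_generated_by[OF _ _ neq])
    let ?S = "{cohomology_ball \<Phi>\<^sub>1 \<Phi>\<^sub>2 1 c r | c r. c \<in> orlicz_cohomology \<Phi>\<^sub>1 \<Phi>\<^sub>2 1 \<and> 0 < r}"
    have cover: "c \<in> \<Union>?S" if "c \<in> H" for c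
    proof -
      \<comment> \<open>A radius above the seminorm of \<open>coset_diff c c\<close> avoids computing that seminorm.\<close>
      define r where "r = \<bar>quotient_seminorm \<Phi>\<^sub>2 (coset_diff c c)\<bar> + 1"
      have "c \<in> cohomology_ball \<Phi>\<^sub>1 \<Phi>\<^sub>2 1 c r" "0 < r"
        using that by (auto simp: cohomology_ball_def H_def r_def)
      then show ?thesis using that unfolding H_def by blast
    qed
    show "cls (\<lambda>_. 0) \<in> \<Union>?S" by (rule cover[OF H[OF zero_closed]])
    show "cls \<omega> \<in> \<Union>?S" by (rule cover[OF H[OF \<omega>]])
    fix B assume "B \<in> ?S" "cls (\<lambda>_. 0) \<in> B"
    then obtain c r where B: "B = cohomology_ball \<Phi>\<^sub>1 \<Phi>\<^sub>2 1 c r" "c \<in> H"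
      and lt: "quotient_seminorm \<Phi>\<^sub>2 (coset_diff (cls (\<lambda>_. 0)) c) < r"
      unfolding cohomology_ball_def H_def by blast
    have "quotient_seminorm \<Phi>\<^sub>2 (coset_diff (cls \<omega>) c)
        \<le> quotient_seminorm \<Phi>\<^sub>2 (coset_diff (cls (\<lambda>_. 0)) c)"
      unfolding cls_def
      by (rule quotient_seminorm_limit_of_exact[OF assms \<omega> approx]) (use H_ne[OF B(2)] in auto)
    then show "cls \<omega> \<in> B"
      using lt H[OF \<omega>] unfolding B cohomology_ball_def H_def by simp
  qed
  moreover have "H \<noteq> {exact_forms \<Phi>\<^sub>1 \<Phi>\<^sub>2 1}"
    using H[OF \<omega>] H[OF zero_closed] neq by auto
  ultimately show ?thesis by (simp add: H_def)
qed

end
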